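(* $17\leq b(2,2,3)\leq 18$.
   Context: The three-colour bipartite Ramsey number $b(2,2,3)$ is the least $N$ such that every colouring of the edges of the complete bipartite graph $K_{N,N}$ with three colours $1,2,3$ contains a $K_{2,2}$ all of whose edges have colour $1$, or a $K_{2,2}$ all of whose edges have colour $2$, or a $K_{3,3}$ all of whose edges have colour $3$ (here a $K_{s,s}$ in $K_{N,N}$ consists of $s$ vertices from each part and the $s^2$ edges between them). *)

theory Defs
  imports Main "HOL-Library.FuncSet"
begin

text \<open>
  The two parts of $K_{N,N}$ are two disjoint copies of \<open>{..<N}\<close>: the edge joining vertex \<open>x\<close> of the
  first part to vertex \<open>y\<close> of the second part is the pair \<open>(x, y)\<close>. A colouring of the edges is
  a function on \<open>{..<N} \<times> {..<N}\<close>; its values elsewhere are irrelevant.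
\<close>

definition mono_Kss :: "nat \<Rightarrow> (nat \<times> nat \<Rightarrow> nat) \<Rightarrow> nat \<Rightarrow> nat \<Rightarrow> bool" where
  "mono_Kss N c i s \<longleftrightarrow>
     (\<exists>A B. A \<subseteq> {..<N} \<and> B \<subseteq> {..<N} \<and> card A = s \<and> card B = s \<and>
            (\<forall>x\<in>A. \<forall>y\<in>B. c (x, y) = i))"

definition bip_arrows :: "nat \<Rightarrow> nat \<Rightarrow> nat \<Rightarrow> nat \<Rightarrow> bool" where
  "bip_arrows N r s t \<longleftrightarrow>
     (\<forall>c \<in> {..<N} \<times> {..<N} \<rightarrow> {1, 2, 3}.
        mono_Kss N c 1 r \<or> mono_Kss N c 2 s \<or> mono_Kss N c 3 t)"

definition bip_ramsey :: "nat \<Rightarrow> nat \<Rightarrow> nat \<Rightarrow> nat" where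
  "bip_ramsey r s t = (LEAST N. bip_arrows N r s t)"

end

theory Submission
  imports Defs
begin

text \<open>
  Upper bound: on 18 + 18 vertices a graph without $K_{2,2}$ has at most 82 edges and a graph without
  $K_{3,3}$ at most 158, while 82 + 82 + 158 < 324. Counting $K_{s,s}$'s globally is too weak for
  this. Instead one fixes a vertex \<open>x\<close> of degree \<open>c\<close> and looks at the traces on its neighbourhood of
  the other 17 neighbourhoods: every \<open>s\<close>-subset lies in at most \<open>s - 2\<close> of them. Convexity then
  bounds the sum of the degrees of the neighbours of \<open>x\<close> in terms of \<open>c\<close>, and summing over all
  \<open>x\<close> gives a sum of squares of degrees, which is bounded below by convexity again (for $K_{2,2}$)
  or cancels against the transposed inequality (for $K_{3,3}$).

  Lower bound: a colouring of $K_{16,16}$ invariant under translations by $Z_4 \times Z_4$.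
\<close>

section \<open>Neighbourhoods, degrees and double counting\<close>

definition biclique_free :: "nat \<Rightarrow> 'a set \<Rightarrow> 'b set \<Rightarrow> ('a \<Rightarrow> 'b \<Rightarrow> bool) \<Rightarrow> bool" where
  "biclique_free s X Y R \<longleftrightarrow>
     (\<nexists>A B. A \<subseteq> X \<and> B \<subseteq> Y \<and> card A = s \<and> card B = s \<and> (\<forall>x\<in>A. \<forall>y\<in>B. R x y))"

lemma biclique_free_transpose:
  "biclique_free s X Y R \<Longrightarrow> biclique_free s Y X (\<lambda>y x. R x y)"
  unfolding biclique_free_def by blast

definition nbhd :: "'b set \<Rightarrow> ('a \<Rightarrow> 'b \<Rightarrow> bool) \<Rightarrow> 'a \<Rightarrow> 'b set" where
  "nbhd Y R x = {y \<in> Y. R x y}"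

text \<open>Integer valued, because the estimates subtract from degrees.\<close>

definition deg :: "'b set \<Rightarrow> ('a \<Rightarrow> 'b \<Rightarrow> bool) \<Rightarrow> 'a \<Rightarrow> int" where
  "deg Y R x = int (card (nbhd Y R x))"

lemma finite_nbhd [simp]: "finite Y \<Longrightarrow> finite (nbhd Y R x)"
  by (simp add: nbhd_def)

lemma deg_le_card: "finite Y \<Longrightarrow> deg Y R x \<le> int (card Y)"
  by (simp add: deg_def nbhd_def card_mono)

text \<open>Double counting of the pairs \<open>(x, T)\<close> with \<open>T\<close> an
  \<open>s\<close>-subset of \<open>N x\<close>.\<close>

lemma sum_choose_le:
  assumes "finite X" "finite Y" "\<And>x. x \<in> X \<Longrightarrow> N x \<subseteq> Y"
    and multiplicity: "\<And>T. T \<subseteq> Y \<Longrightarrow> card T = s \<Longrightarrow> card {x \<in> X. T \<subseteq> N x} \<le> k"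
  shows "(\<Sum>x\<in>X. card (N x) choose s) \<le> k * (card Y choose s)"
proof -
  let ?T = "{T. T \<subseteq> Y \<and> card T = s}"
  have finT: "finite ?T" using \<open>finite Y\<close> by simp
  have "(\<Sum>x\<in>X. card (N x) choose s) = (\<Sum>x\<in>X. \<Sum>T | T \<in> ?T \<and> T \<subseteq> N x. 1)"
  proof (rule sum.cong)
    fix x assume "x \<in> X"
    then have "N x \<subseteq> Y" using assms(3) by blast
    then have "{T. T \<in> ?T \<and> T \<subseteq> N x} = {T. T \<subseteq> N x \<and> card T = s}" by blast
    then show "card (N x) choose s = (\<Sum>T | T \<in> ?T \<and> T \<subseteq> N x. 1)"
      using n_subsets[of "N x" s] \<open>N x \<subseteq> Y\<close> \<open>finite Y\<close> finite_subset by fastforce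
  qed simp
  also have "\<dots> = (\<Sum>T\<in>?T. \<Sum>x | x \<in> X \<and> T \<subseteq> N x. 1)"
    by (rule sum.swap_restrict[OF \<open>finite X\<close> finT])
  also have "\<dots> \<le> (\<Sum>T\<in>?T. k)"
    by (rule sum_mono) (use multiplicity in simp)
  also have "\<dots> = k * (card Y choose s)"
    using n_subsets[OF \<open>finite Y\<close>] by simp
  finally show ?thesis .
qed

text \<open>An \<open>s\<close>-set \<open>T\<close> contained in the traces of \<open>s - 1\<close>
  other vertices would form a K(s,s) together with these vertices and \<open>x\<close>.\<close>

lemma sum_codegree_choose_le:
  assumes "biclique_free s X Y R" "finite X" "finite Y" "x \<in> X" "2 \<le> s"
  shows "(\<Sum>x'\<in>X - {x}. card (nbhd Y R x \<inter> nbhd Y R x') choose s)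
           \<le> (s - 2) * (card (nbhd Y R x) choose s)"
proof (rule sum_choose_le)
  fix T assume T: "T \<subseteq> nbhd Y R x" "card T = s"
  let ?A = "{x' \<in> X - {x}. T \<subseteq> nbhd Y R x \<inter> nbhd Y R x'}"
  show "card ?A \<le> s - 2"
  proof (rule ccontr)
    assume "\<not> card ?A \<le> s - 2"
    then have "s - 1 \<le> card ?A" using \<open>2 \<le> s\<close> by linarith
    then obtain A where A: "A \<subseteq> ?A" "card A = s - 1"
      by (rule obtain_subset_with_card_n)
    have "A \<subseteq> X" using A(1) by blast
    then have "finite A" using \<open>finite X\<close> finite_subset by blast
    moreover have "x \<notin> A" using A(1) by blast
    ultimately have "card (insert x A) = s" using A(2) \<open>2 \<le> s\<close> by simp
    moreover have "insert x A \<subseteq> X" using \<open>A \<subseteq> X\<close> \<open>x \<in> X\<close> by blast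
    moreover have "T \<subseteq> Y" using T(1) by (auto simp: nbhd_def)
    moreover have "\<forall>x'\<in>insert x A. \<forall>y\<in>T. R x' y"
      using A(1) T(1) by (auto simp: nbhd_def)
    ultimately show False
      using assms(1) T(2) unfolding biclique_free_def by metis
  qed
qed (use assms in simp_all)

lemma sum_nbhd_swap:
  fixes g :: "'b \<Rightarrow> int"
  assumes "finite X" "finite Y"
  shows "(\<Sum>x\<in>X. \<Sum>y\<in>nbhd Y R x. g y) = (\<Sum>y\<in>Y. deg X (\<lambda>y x. R x y) y * g y)"
  using sum.swap_restrict[OF assms, of "\<lambda>x y. g y" R]
  by (simp add: nbhd_def deg_def)

lemma sum_deg_swap:
  assumes "finite X" "finite Y"
  shows "(\<Sum>x\<in>X. deg Y R x) = (\<Sum>y\<in>Y. deg X (\<lambda>y x. R x y) y)"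
  using sum_nbhd_swap[OF assms, where R = R and g = "\<lambda>_. 1"] by (simp add: deg_def)

text \<open>Both sides count the paths \<open>x\<close>, \<open>y\<close>, \<open>x'\<close>; the
  \<open>- 1\<close> discards \<open>x\<close> itself as end point.\<close>

lemma sum_codegree:
  assumes "finite X" "finite Y" "x \<in> X"
  shows "(\<Sum>x'\<in>X - {x}. int (card (nbhd Y R x \<inter> nbhd Y R x')))
           = (\<Sum>y\<in>nbhd Y R x. deg X (\<lambda>y x. R x y) y - 1)"
proof -
  have "(\<Sum>x'\<in>X - {x}. int (card (nbhd Y R x \<inter> nbhd Y R x')))
          = (\<Sum>x'\<in>X - {x}. \<Sum>y | y \<in> nbhd Y R x \<and> R x' y. 1)"
    by (rule sum.cong) (auto simp: nbhd_def intro!: arg_cong[where f = card])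
  also have "\<dots> = (\<Sum>y\<in>nbhd Y R x. \<Sum>x' | x' \<in> X - {x} \<and> R x' y. 1)"
    by (rule sum.swap_restrict) (use assms in auto)
  also have "\<dots> = (\<Sum>y\<in>nbhd Y R x. deg X (\<lambda>y x. R x y) y - 1)"
  proof (rule sum.cong)
    fix y assume y: "y \<in> nbhd Y R x"
    have "nbhd X (\<lambda>y x. R x y) y = insert x {x'. x' \<in> X - {x} \<and> R x' y}"
      using y \<open>x \<in> X\<close> by (auto simp: nbhd_def)
    then show "(\<Sum>x' | x' \<in> X - {x} \<and> R x' y. 1) = deg X (\<lambda>y x. R x y) y - 1"
      using \<open>finite X\<close> by (simp add: deg_def)
  qed simp
  finally show ?thesis .
qed

subsection \<open>Graphs without K(2,2) on 18 + 18 vertices\<close>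

text \<open>For \<open>s = 2\<close> the bound of \<open>sum_codegree_choose_le\<close> is 0, so no
  trace has two elements and each other vertex contributes at most 1.\<close>

lemma K22_free_nbhd_sum:
  assumes "biclique_free 2 X Y R" "finite X" "finite Y" "x \<in> X"
  shows "(\<Sum>y\<in>nbhd Y R x. deg X (\<lambda>y x. R x y) y - 1) \<le> int (card X) - 1"
proof -
  let ?t = "\<lambda>x'. card (nbhd Y R x \<inter> nbhd Y R x')"
  have "int (?t x') \<le> 1" if "x' \<in> X - {x}" for x'
  proof (rule ccontr)
    assume "\<not> int (?t x') \<le> 1"
    then have "?t x' choose 2 > 0" by (simp add: zero_less_binomial_iff)
    moreover have "?t x' choose 2 = 0"
      using sum_codegree_choose_le[OF assms] that \<open>finite X\<close> by (simp add: sum_nonneg_eq_0_iff)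
    ultimately show False by simp
  qed
  then have "(\<Sum>x'\<in>X - {x}. int (?t x')) \<le> (\<Sum>x'\<in>X - {x}. 1)"
    by (rule sum_mono)
  moreover have "int (card (X - {x})) = int (card X) - 1"
    using card.remove[OF \<open>finite X\<close> \<open>x \<in> X\<close>] by simp
  ultimately show ?thesis
    using sum_codegree[OF assms(2-4), where R = R] by simp
qed

lemma K22_free_edges_18:
  assumes free: "biclique_free 2 X Y R" and X: "card X = 18" and Y: "card Y = 18"
  shows "(\<Sum>x\<in>X. deg Y R x) \<le> 82"
proof -
  have fin: "finite X" "finite Y" using X Y by (auto intro: card_ge_0_finite)
  define d where "d = deg X (\<lambda>y x. R x y)"
  define E where "E = (\<Sum>x\<in>X. deg Y R x)"
  have Ed: "E = (\<Sum>y\<in>Y. d y)" unfolding E_def d_def by (rule sum_deg_swap[OF fin])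
  have row: "(\<Sum>y\<in>nbhd Y R x. d y - 1) \<le> 17" if "x \<in> X" for x
    using K22_free_nbhd_sum[OF free fin that] X by (simp add: d_def)
  \<comment> \<open>A row with at most four entries can only reach the sum 17 by using columns of degree above 5;
    this is what improves the bound 83, obtained from \<open>row\<close> alone, to 82.\<close>
  have short_row: "(\<Sum>y\<in>nbhd Y R x. d y - 1) + 5 - deg Y R x
      \<le> 17 + (\<Sum>y\<in>nbhd Y R x. max 0 (d y - 5))" if "x \<in> X" for x
  proof (cases "deg Y R x \<le> 4")
    case True
    have "(\<Sum>y\<in>nbhd Y R x. d y - 1) \<le> (\<Sum>y\<in>nbhd Y R x. 4 + max 0 (d y - 5))"
      by (rule sum_mono) simp
    also have "\<dots> = 4 * deg Y R x + (\<Sum>y\<in>nbhd Y R x. max 0 (d y - 5))"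
      by (simp add: sum.distrib deg_def)
    finally show ?thesis using True by simp
  next
    case False
    have "0 \<le> (\<Sum>y\<in>nbhd Y R x. max 0 (d y - 5))" by (simp add: sum_nonneg)
    then show ?thesis using row[OF that] False by linarith
  qed
  have "(\<Sum>x\<in>X. \<Sum>y\<in>nbhd Y R x. d y - 1) \<le> (\<Sum>x\<in>X. 17)"
    by (rule sum_mono) (rule row)
  then have 1: "(\<Sum>y\<in>Y. d y * (d y - 1)) \<le> 306"
    using sum_nbhd_swap[OF fin, where R = R and g = "\<lambda>y. d y - 1"] X by (simp add: d_def)
  have "(\<Sum>x\<in>X. (\<Sum>y\<in>nbhd Y R x. d y - 1) + 5 - deg Y R x)
      \<le> (\<Sum>x\<in>X. 17 + (\<Sum>y\<in>nbhd Y R x. max 0 (d y - 5)))"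
    by (rule sum_mono) (rule short_row)
  then have 2: "(\<Sum>y\<in>Y. d y * (d y - 1)) - E \<le> 216 + (\<Sum>y\<in>Y. d y * max 0 (d y - 5))"
    using sum_nbhd_swap[OF fin, where R = R and g = "\<lambda>y. d y - 1"] X
      sum_nbhd_swap[OF fin, where R = R and g = "\<lambda>y. max 0 (d y - 5)"]
    by (simp add: d_def E_def sum.distrib sum_subtractf)
  \<comment> \<open>The right-hand side is the combination that arises from twice \<open>1\<close>
    plus \<open>2\<close>. Equality holds at 4, 5 and 6.\<close>
  have tangent: "24 * n - 60 \<le> 3 * (n * (n - 1)) - n * max 0 (n - 5)" for n :: int
  proof (cases "n \<le> 5")
    case True
    have "0 \<le> (n - 4) * (n - 5)" using True by (cases "n = 5") (auto simp: mult_nonpos_nonpos)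
    then show ?thesis using True by (simp add: algebra_simps)
  next
    case False
    have "0 \<le> (n - 5) * (n - 6)" using False by (simp add: mult_nonneg_nonneg)
    then show ?thesis using False by (simp add: algebra_simps)
  qed
  have "(\<Sum>y\<in>Y. 24 * d y - 60) \<le> (\<Sum>y\<in>Y. 3 * (d y * (d y - 1)) - d y * max 0 (d y - 5))"
    by (rule sum_mono) (rule tangent)
  then have "24 * E - 1080
      \<le> 3 * (\<Sum>y\<in>Y. d y * (d y - 1)) - (\<Sum>y\<in>Y. d y * max 0 (d y - 5))"
    using Y by (simp add: Ed sum_subtractf sum_distrib_left)
  \<comment> \<open>Twice \<open>1\<close> plus \<open>2\<close> yields
    \<open>23 * E \<le> 1908\<close>, just below \<open>23 * 83 = 1909\<close>.\<close>
  then show ?thesis using 1 2 unfolding E_def[symmetric] by linarith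
qed

subsection \<open>Graphs without K(3,3) on 18 + 18 vertices\<close>

text \<open>The lines through the graph of $t \mapsto {t \choose 3}$ at 3, 4 and at 4, 5; they are the
  relevant ones because the mean trace size is slightly above 4 for a vertex of degree 9.\<close>

lemma choose_3_tangent_3: "3 * int t - 8 \<le> int (t choose 3)"
proof (induction t)
  case (Suc t)
  show ?case
  proof (cases "t < 3")
    case True
    then have "t \<in> {0,1,2}" by auto
    then show ?thesis by (auto simp: numeral_eq_Suc)
  next
    case False
    then have "3 choose 2 \<le> t choose 2" by (intro binomial_right_mono) simp
    with Suc show ?thesis by (simp add: numeral_eq_Suc)
  qed
qed simp

lemma choose_3_tangent_6: "6 * int t - 20 \<le> int (t choose 3)"
proof (induction t)
  case (Suc t)
  show ?case
  proof (cases "t < 4")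
    case True
    then have "t \<in> {0,1,2,3}" by auto
    then show ?thesis by (auto simp: numeral_eq_Suc)
  next
    case False
    then have "4 choose 2 \<le> t choose 2" by (intro binomial_right_mono) simp
    with Suc show ?thesis by (simp add: numeral_eq_Suc)
  qed
qed simp

lemma choose_2_int: "2 * int (n choose 2) = int n * (int n - 1)"
  by (induction n) (simp_all add: numeral_2_eq_2 algebra_simps)

lemma choose_3_int: "6 * int (n choose 3) = int n * (int n - 1) * (int n - 2)"
proof (induction n)
  case (Suc n)
  have "Suc n choose 3 = (n choose 2) + (n choose 3)" by (simp add: numeral_3_eq_3 numeral_2_eq_2)
  with Suc choose_2_int[of n] show ?case by (simp add: algebra_simps)
qed simp

text \<open>The 17 traces have total size \<open>S\<close>. Packing bounds the sum of their numbers
  of triples by \<open>c choose 3\<close>, and each tangent line turns this into a linear bound on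
  \<open>S\<close>.\<close>

lemma K33_free_nbhd_sum:
  assumes free: "biclique_free 3 X Y R" and X: "card X = 18" and Y: "card Y = 18" and x: "x \<in> X"
  shows "(\<Sum>y\<in>nbhd Y R x. deg X (\<lambda>y x. R x y) y) \<le> deg Y R x ^ 2 - 10 * deg Y R x + 88"
proof -
  have fin: "finite X" "finite Y" using X Y by (auto intro: card_ge_0_finite)
  let ?t = "\<lambda>x'. card (nbhd Y R x \<inter> nbhd Y R x')"
  define c where "c = card (nbhd Y R x)"
  define S where "S = (\<Sum>x'\<in>X - {x}. int (?t x'))"
  have cardX: "card (X - {x}) = 17" using X x fin by simp
  have pack: "(\<Sum>x'\<in>X - {x}. int (?t x' choose 3)) \<le> int (c choose 3)"
    using sum_codegree_choose_le[OF free fin x] unfolding c_def of_nat_sum[symmetric] of_nat_le_iff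
    by simp
  have "(\<Sum>x'\<in>X - {x}. 3 * int (?t x') - 8) \<le> (\<Sum>x'\<in>X - {x}. int (?t x' choose 3))"
    by (rule sum_mono) (rule choose_3_tangent_3)
  with pack have low: "3 * S - 136 \<le> int (c choose 3)"
    by (simp add: S_def sum_subtractf sum_distrib_left cardX)
  have "(\<Sum>x'\<in>X - {x}. 6 * int (?t x') - 20) \<le> (\<Sum>x'\<in>X - {x}. int (?t x' choose 3))"
    by (rule sum_mono) (rule choose_3_tangent_6)
  with pack have high: "6 * S - 340 \<le> int (c choose 3)"
    by (simp add: S_def sum_subtractf sum_distrib_left cardX)
  have "c \<le> 18" using deg_le_card[OF fin(2), where R = R and x = x] Y by (simp add: deg_def c_def)
  then have "c \<in> {0,1,2,3,4,5,6,7,8,9,10,11,12,13,14,15,16,17,18}"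
    by (simp only: insert_iff empty_iff) presburger
  \<comment> \<open>The monic quadratic that takes the integer bounds 64 at \<open>c = 8\<close>
    (from \<open>low\<close>) and 70 at \<open>c = 9\<close> (from \<open>high\<close>); the other
    degrees leave slack. Leading coefficient 1 lets the squares cancel later.\<close>
  then have "S \<le> int c ^ 2 - 11 * int c + 88"
    using low high choose_3_int[of c] by (elim insertE) (simp_all add: binomial_eq_0)
  moreover have "S = (\<Sum>y\<in>nbhd Y R x. deg X (\<lambda>y x. R x y) y) - int c"
    unfolding S_def by (simp add: sum_codegree[OF fin x] sum_subtractf c_def)
  ultimately show ?thesis by (simp add: deg_def c_def)
qed

text \<open>Sum \<open>K33_free_nbhd_sum\<close> over \<open>X\<close>: each \<open>y\<close> occurs
  once per neighbour, so its degree gets squared.\<close>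

lemma K33_free_sum_squares:
  assumes free: "biclique_free 3 X Y R" and X: "card X = 18" and Y: "card Y = 18"
  shows "(\<Sum>y\<in>Y. deg X (\<lambda>y x. R x y) y ^ 2)
           \<le> (\<Sum>x\<in>X. deg Y R x ^ 2) - 10 * (\<Sum>x\<in>X. deg Y R x) + 1584"
proof -
  have fin: "finite X" "finite Y" using X Y by (auto intro: card_ge_0_finite)
  have "(\<Sum>x\<in>X. \<Sum>y\<in>nbhd Y R x. deg X (\<lambda>y x. R x y) y)
      \<le> (\<Sum>x\<in>X. deg Y R x ^ 2 - 10 * deg Y R x + 88)"
    by (rule sum_mono) (rule K33_free_nbhd_sum[OF free X Y])
  then show ?thesis
    unfolding sum_nbhd_swap[OF fin]
    by (simp add: X sum.distrib sum_subtractf sum_distrib_left power2_eq_square)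
qed

text \<open>Adding the previous inequality and its transpose cancels the squares: 20 times the
  number of edges is at most 3168.\<close>

lemma K33_free_edges_18:
  assumes free: "biclique_free 3 X Y R" and X: "card X = 18" and Y: "card Y = 18"
  shows "(\<Sum>x\<in>X. deg Y R x) \<le> 158"
proof -
  have fin: "finite X" "finite Y" using X Y by (auto intro: card_ge_0_finite)
  show ?thesis
    using K33_free_sum_squares[OF free X Y]
      K33_free_sum_squares[OF biclique_free_transpose[OF free] Y X] sum_deg_swap[OF fin, where R = R]
    by linarith
qed

section \<open>The upper bound for the Ramsey number\<close>

lemma biclique_free_colour_class:
  "biclique_free s {..<N} {..<N} (\<lambda>x y. c (x, y) = i) \<longleftrightarrow> \<not> mono_Kss N c i s"
  by (simp add: biclique_free_def mono_Kss_def)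

lemma bip_arrows_18: "bip_arrows 18 2 2 3"
  unfolding bip_arrows_def
proof (intro ballI, rule ccontr)
  fix c :: "nat \<times> nat \<Rightarrow> nat" assume c: "c \<in> {..<18} \<times> {..<18} \<rightarrow> {1, 2, 3}"
  assume no: "\<not> (mono_Kss 18 c 1 2 \<or> mono_Kss 18 c 2 2 \<or> mono_Kss 18 c 3 3)"
  let ?deg = "\<lambda>i. deg {..<18} (\<lambda>x y. c (x, y) = i)"
  have "(\<Sum>x<18. ?deg 1 x) \<le> 82" "(\<Sum>x<18. ?deg 2 x) \<le> 82" "(\<Sum>x<18. ?deg 3 x) \<le> 158"
    using no by (auto intro!: K22_free_edges_18 K33_free_edges_18 simp: biclique_free_colour_class)
  moreover have "?deg 1 x + ?deg 2 x + ?deg 3 x = 18" if "x < 18" for x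
  proof -
    let ?N = "\<lambda>i. nbhd {..<18} (\<lambda>x y. c (x, y) = i) x"
    have "?N 1 \<union> ?N 2 \<union> ?N 3 = {..<18}"
      using c that by (auto simp: nbhd_def Pi_iff)
    moreover have "card (?N 1 \<union> ?N 2 \<union> ?N 3) = card (?N 1) + card (?N 2) + card (?N 3)"
      by (subst card_Un_disjoint, auto simp: nbhd_def)+
    ultimately show ?thesis by (simp add: deg_def)
  qed
  then have "(\<Sum>x<18. ?deg 1 x + ?deg 2 x + ?deg 3 x) = (\<Sum>x<18::nat. 18)"
    by (intro sum.cong) auto
  ultimately show False by (simp add: sum.distrib)
qed

text \<open>Lets a single colouring for \<open>N = 16\<close> refute all smaller \<open>N\<close> as
  well.\<close>

lemma mono_Kss_mono:
  assumes "M \<le> N" "mono_Kss M c i s"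
  shows "mono_Kss N c i s"
proof -
  obtain A B where "A \<subseteq> {..<M}" "B \<subseteq> {..<M}" "card A = s" "card B = s"
    "\<forall>x\<in>A. \<forall>y\<in>B. c (x, y) = i"
    using assms(2) unfolding mono_Kss_def by blast
  moreover have "A \<subseteq> {..<N}" "B \<subseteq> {..<N}"
    using \<open>A \<subseteq> {..<M}\<close> \<open>B \<subseteq> {..<M}\<close> assms(1) by auto
  ultimately have "A \<subseteq> {..<N} \<and> B \<subseteq> {..<N} \<and> card A = s \<and> card B = s \<and>
    (\<forall>x\<in>A. \<forall>y\<in>B. c (x, y) = i)"
    by simp
  then show ?thesis unfolding mono_Kss_def by (intro exI)
qed

subsection \<open>A colouring of K(16,16)\<close>

text \<open>An executable branching search: \<open>s\<close> vertices are still to be chosen from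
  \<open>xs\<close>, and \<open>ys\<close> lists the common neighbours of those already chosen. A
  branch is cut once fewer than \<open>t\<close> of them remain.\<close>

fun no_biclique :: "('a \<Rightarrow> 'b \<Rightarrow> bool) \<Rightarrow> nat \<Rightarrow> nat \<Rightarrow> 'a list \<Rightarrow> 'b list \<Rightarrow> bool" where
  "no_biclique R 0 t xs ys \<longleftrightarrow> length ys < t"
| "no_biclique R (Suc s) t [] ys \<longleftrightarrow> True"
| "no_biclique R (Suc s) t (x # xs) ys \<longleftrightarrow>
     (if length ys < t then True
      else no_biclique R s t xs (filter (R x) ys) \<and> no_biclique R (Suc s) t xs ys)"

text \<open>Follow the branch that agrees with \<open>A\<close>: if \<open>x \<in> A\<close>, then
  \<open>B\<close> survives the filter and \<open>A - {x}\<close> remains; otherwise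
  \<open>x\<close> is skipped.\<close>

lemma no_biclique_sound:
  assumes "no_biclique R s t xs ys" "A \<subseteq> set xs" "card A = s" "B \<subseteq> set ys"
    and "\<forall>x\<in>A. \<forall>y\<in>B. R x y"
  shows "card B < t"
  using assms
proof (induction R s t xs ys arbitrary: A rule: no_biclique.induct)
  case (1 R t xs ys)
  then show ?case using card_mono[of "set ys" B] card_length[of ys] by simp
next
  case (2 R s t ys)
  then show ?case by simp
next
  case (3 R s t x xs ys)
  have fin: "finite A" using "3.prems"(2) by (rule finite_subset) simp
  show ?case
  proof (cases "length ys < t")
    case True
    then show ?thesis using "3.prems"(4) card_mono[of "set ys" B] card_length[of ys] by simp
  next
    case long: False
    show ?thesis
    proof (cases "x \<in> A")
      case True
      show ?thesis
        by (rule "3.IH"(1)[of "A - {x}"]) (use "3.prems" long True fin in auto)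
    next
      case False
      show ?thesis
        by (rule "3.IH"(2)[of A]) (use "3.prems" long False in auto)
    qed
  qed
qed

lemma no_biclique_not_mono_Kss:
  assumes "no_biclique (\<lambda>x y. c (x, y) = i) s s [0..<N] [0..<N]"
  shows "\<not> mono_Kss N c i s"
proof
  assume "mono_Kss N c i s"
  then obtain A B where "A \<subseteq> {..<N}" "B \<subseteq> {..<N}" "card A = s" "card B = s"
    "\<forall>x\<in>A. \<forall>y\<in>B. c (x, y) = i"
    unfolding mono_Kss_def by blast
  then have "card B < s"
    by (intro no_biclique_sound[OF assms, of A B]) (auto simp: atLeast0LessThan)
  then show False using \<open>card B = s\<close> by simp
qed

text \<open>The vertex \<open>4 a + b\<close> stands for \<open>(a, b)\<close> in the group $Z_4 \times Z_4$, and the colour of an edge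
  depends only on the difference of its end points.\<close>

definition cayley_colouring :: "nat \<times> nat \<Rightarrow> nat" where
  "cayley_colouring = (\<lambda>(x, y).
     [3, 3, 3, 1,  3, 3, 3, 2,  1, 2, 2, 3,  1, 1, 2, 3] !
       (4 * ((x div 4 + 4 - y div 4) mod 4) + (x mod 4 + 4 - y mod 4) mod 4))"

lemma cayley_colouring_1: "\<not> mono_Kss 16 cayley_colouring 1 2"
  by (rule no_biclique_not_mono_Kss) code_simp

lemma cayley_colouring_2: "\<not> mono_Kss 16 cayley_colouring 2 2"
  by (rule no_biclique_not_mono_Kss) code_simp

lemma cayley_colouring_3: "\<not> mono_Kss 16 cayley_colouring 3 3"
  by (rule no_biclique_not_mono_Kss) code_simp

lemma cayley_colouring_range: "cayley_colouring p \<in> {1, 2, 3}"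
proof -
  let ?L = "[3, 3, 3, 1,  3, 3, 3, 2,  1, 2, 2, 3,  1, 1, 2, 3] :: nat list"
  obtain x y where p: "p = (x, y)" by fastforce
  let ?k = "4 * ((x div 4 + 4 - y div 4) mod 4) + (x mod 4 + 4 - y mod 4) mod 4"
  \<comment> \<open>Both residues are below 4, so the index is at most 15, even for arguments
    outside the grid where the subtraction may truncate.\<close>
  have "?k < length ?L" by simp
  then have "?L ! ?k \<in> set ?L" by (rule nth_mem)
  then show ?thesis by (auto simp: p cayley_colouring_def)
qed

lemma not_bip_arrows: "N \<le> 16 \<Longrightarrow> \<not> bip_arrows N 2 2 3"
  unfolding bip_arrows_def
  using cayley_colouring_range cayley_colouring_1 cayley_colouring_2 cayley_colouring_3
    mono_Kss_mono[of N 16 cayley_colouring] by blast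

theorem theorem4p2:
  shows "17 \<le> bip_ramsey 2 2 3 \<and> bip_ramsey 2 2 3 \<le> 18"
proof
  \<comment> \<open>The least \<open>N\<close> is attained because 18 is a witness, so it cannot be
    among the values up to 16.\<close>
  have "bip_arrows (bip_ramsey 2 2 3) 2 2 3"
    unfolding bip_ramsey_def by (rule LeastI) (rule bip_arrows_18)
  then show "17 \<le> bip_ramsey 2 2 3"
    using not_bip_arrows[of "bip_ramsey 2 2 3"] by fastforce
  show "bip_ramsey 2 2 3 \<le> 18"
    unfolding bip_ramsey_def by (rule Least_le) (rule bip_arrows_18)
qed

end
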